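(* Let $C$ be a closed convex cone in $H$, $K$ a nonempty closed convex subset of $C$, and let $f:C\to H$ and $g:H\to H$ be weakly homogeneous mappings of degrees $\delta_1>0$ and $\delta_2>0$, respectively, written $f=f^\infty+\bar f+p$ and $g=g^\infty+\bar g+q$. Let $F,F^\infty:H\to H$ be any given continuous extensions of $f$ and $f^\infty$, respectively. Suppose that $g^{-1}(C)\subseteq C$, that $\bar g(x)+q\in C$ as $\|x\|\to\infty$ (i.e. for all $x\in H$ with $\|x\|$ sufficiently large), and that the following conditions hold: (a) SOL$(f^\infty,g^\infty,K^\infty)=\{0\}$; and (b) $\mathrm{ind}\big((F^\infty,g^\infty)^{nat}_{K^\infty},0\big)\ne 0$, where $(F^\infty,g^\infty)^{nat}_{K^\infty}(x):=g^\infty(x)-\Pi_{K^\infty}[g^\infty(x)-F^\infty(x)]$ for $x\in H$. If additionally $f$ is strictly monotone with respect to $g$ on $K$, then WHGVI$(f,g,K)$ has a unique solution. If additionally $f$ is strictly monotone with respect to $g$ on $K^\infty$, then WHGCP$(f,g,K^\infty)$ has a unique solution.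
   Context: $H$ is a finite dimensional real Hilbert space with inner product $\langle\cdot,\cdot\rangle$ and norm $\|\cdot\|$; $\Pi_S$ is the orthogonal projection onto a closed convex set $S$; $g^{-1}(C)=\{x\in H\mid g(x)\in C\}$; the dual cone of $S$ is $S^*=\{u\in H\mid \langle u,x\rangle\ge0\ \forall x\in S\}$; the recession cone of $K$ is $K^\infty:=\{u\in H\mid \exists t_k\to\infty,\ \exists x^k\in K \text{ such that } x^k/t_k\to u\}$. Weakly homogeneous mappings: let $D\subseteq H$ be a closed convex cone ($D=C$ for $f$, $D=H$ for $g$). A continuous $h:D\to H$ is positively homogeneous of degree $\delta$ if $h(\lambda x)=\lambda^\delta h(x)$ for all $x\in D$, $\lambda>0$. A mapping $\varphi:D\to H$ is weakly homogeneous of degree $\delta>0$ if $\varphi=h+e$ with $h$ positively homogeneous of degree $\delta$ and $e:D\to H$ continuous with $e(x)/\|x\|^\delta\to0$ as $\|x\|\to\infty$ in $D$; $h$ is unique, is called the leading term and is denoted $\varphi^\infty$. In $f=f^\infty+\bar f+p$, $p\in H$ is the constant item and $\bar f:=f-f^\infty-p$; likewise $q\in H$ and $\bar g:=g-g^\infty-q$, so $\bar g+q=g-g^\infty$. For mappings $\phi$ (on $C$ or $H$), $\psi:H\to H$ and closed convex $S$, SOL$(\phi,\psi,S)$ is the set of $x$ such that $\psi(x)\in S$ and $\langle\phi(x),y-\psi(x)\rangle\ge0$ for all $y\in S$; if $S$ is a cone this is equivalent to $\psi(x)\in S$, $\phi(x)\in S^*$, $\langle\phi(x),\psi(x)\rangle=0$.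 WHGVI$(f,g,K)$ is the problem with solution set SOL$(f,g,K)$, and WHGCP$(f,g,K^\infty)$ is the problem of finding $x\in H$ with $g(x)\in K^\infty$, $f(x)\in(K^\infty)^*$, $\langle f(x),g(x)\rangle=0$. $f$ is strictly monotone with respect to $g$ on $S$ if $g(x),g(y)\in S$ and $x\ne y$ imply $\langle f(x)-f(y),g(x)-g(y)\rangle>0$. If $x^*$ is an isolated zero of a continuous $\phi:H\to H$, $\mathrm{ind}(\phi,x^* )$ is the topological (Brouwer) degree $\deg(\phi,\Omega',0)$ for any bounded open $\Omega'\ni x^*$ such that $x^*$ is the only zero of $\phi$ in $\bar{\Omega'}$. *)

theory Defs
  imports "HOL-Analysis.Analysis" "HOL-Homology.Homology"
begin

text \<open>
  The Hilbert space is a type of class \<open>euclidean_space\<close>. A mapping defined only on a set \<open>D\<close> is a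
  total function accompanied by \<open>D\<close>; its values outside \<open>D\<close> are never used.
\<close>

section \<open>Brouwer degree and index of an isolated zero\<close>

text \<open>
  The homological definition of the degree (Dold, Lectures on Algebraic Topology, Chapters IV and
  VIII). Put \<open>n = DIM('a)\<close>, \<open>Z = \<Omega> \<inter> \<phi>\<^sup>-\<^sup>1(y)\<close> and let \<open>B\<close> be a closed ball about \<open>0\<close> containing
  \<open>\<Omega>\<close> and \<open>y\<close>. If \<open>\<Omega>\<close> is open and bounded, \<open>\<phi>\<close> is continuous on the closure of \<open>\<Omega>\<close> and \<open>y\<close> has no
  preimage on the frontier of \<open>\<Omega>\<close>, then \<open>Z\<close> is compact, and excision makes the left arrow of
  \<open>H\<^sub>n(\<Omega>, \<Omega> - Z) \<longrightarrow> H\<^sub>n(E, E - Z) \<longleftarrow> H\<^sub>n(E, E - B)\<close> an isomorphism, so each class \<open>b\<close> on the right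
  determines a class \<open>a\<close> on the left. The degree is the integer \<open>d\<close> such that \<open>\<phi>\<close> maps \<open>a\<close> to \<open>d\<close>
  times the image of \<open>b\<close> in \<open>H\<^sub>n(E, E - {y})\<close>. The map \<open>H\<^sub>n(E, E - B) \<longrightarrow> H\<^sub>n(E, E - {y})\<close> is an
  isomorphism of infinite cyclic groups whenever \<open>\<Omega>\<close> is nonempty. Comparing with \<open>b\<close> itself, rather
  than with a chosen generator, makes the choice of an orientation unnecessary. The library writes
  homology groups multiplicatively.
\<close>

definition is_brouwer_degree ::
    "('a::euclidean_space \<Rightarrow> 'a) \<Rightarrow> 'a set \<Rightarrow> 'a \<Rightarrow> int \<Rightarrow> bool" where
  "is_brouwer_degree \<phi> \<Omega> y d \<longleftrightarrow>
     (let n = int DIM('a); Z = {x \<in> \<Omega>. \<phi> x = y} in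
      \<forall>r a b.
        \<Omega> \<subseteq> cball 0 r \<and> y \<in> cball 0 r \<and>
        a \<in> carrier (relative_homology_group n (top_of_set \<Omega>) (\<Omega> - Z)) \<and>
        b \<in> carrier (relative_homology_group n (euclidean :: 'a topology) (- cball 0 r)) \<and>
        hom_induced n (top_of_set \<Omega>) (\<Omega> - Z) euclidean (- Z) id a =
          hom_induced n euclidean (- cball 0 r) euclidean (- Z) id b
        \<longrightarrow>
        hom_induced n (top_of_set \<Omega>) (\<Omega> - Z) euclidean (- {y}) \<phi> a =
          hom_induced n euclidean (- cball 0 r) euclidean (- {y}) id b
            [^]\<^bsub>relative_homology_group n euclidean (- {y})\<^esub> d)"

definition brouwer_degree :: "('a::euclidean_space \<Rightarrow> 'a) \<Rightarrow> 'a set \<Rightarrow> 'a \<Rightarrow> int" where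
  "brouwer_degree \<phi> \<Omega> y = (THE d. is_brouwer_degree \<phi> \<Omega> y d)"

definition isolating :: "('a::euclidean_space \<Rightarrow> 'a) \<Rightarrow> 'a \<Rightarrow> 'a set \<Rightarrow> bool" where
  "isolating \<phi> x \<Omega> \<longleftrightarrow> open \<Omega> \<and> bounded \<Omega> \<and> x \<in> \<Omega> \<and> {z \<in> closure \<Omega>. \<phi> z = 0} = {x}"

definition brouwer_index :: "('a::euclidean_space \<Rightarrow> 'a) \<Rightarrow> 'a \<Rightarrow> int" where
  "brouwer_index \<phi> x = (THE d. \<forall>\<Omega>. isolating \<phi> x \<Omega> \<longrightarrow> brouwer_degree \<phi> \<Omega> 0 = d)"


section \<open>Cones and weakly homogeneous mappings\<close>

definition dual_cone :: "'a::real_inner set \<Rightarrow> 'a set" where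
  "dual_cone S = {u. \<forall>x\<in>S. u \<bullet> x \<ge> 0}"

definition recession_cone :: "'a::real_normed_vector set \<Rightarrow> 'a set" where
  "recession_cone K =
     {u. \<exists>(t :: nat \<Rightarrow> real) x. filterlim t at_top sequentially \<and> (\<forall>k. x k \<in> K) \<and>
           (\<lambda>k. x k /\<^sub>R t k) \<longlonglongrightarrow> u}"

definition positively_homogeneous_on ::
    "'a::euclidean_space set \<Rightarrow> real \<Rightarrow> ('a \<Rightarrow> 'a) \<Rightarrow> bool" where
  "positively_homogeneous_on D \<delta> h \<longleftrightarrow>
     continuous_on D h \<and> (\<forall>x\<in>D. \<forall>c>0. h (c *\<^sub>R x) = (c powr \<delta>) *\<^sub>R h x)"

text \<open>
  \<open>weakly_homogeneous_on D \<delta> \<phi> h\<close>: \<open>\<phi>\<close> is weakly homogeneous of degree \<open>\<delta>\<close> on \<open>D\<close> with leading term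
  \<open>h\<close>. The leading term is unique on \<open>D\<close> only, hence a relation instead of a function \<open>\<phi> \<mapsto> \<phi>\<^sup>\<infinity>\<close>.
\<close>

definition weakly_homogeneous_on ::
    "'a::euclidean_space set \<Rightarrow> real \<Rightarrow> ('a \<Rightarrow> 'a) \<Rightarrow> ('a \<Rightarrow> 'a) \<Rightarrow> bool" where
  "weakly_homogeneous_on D \<delta> \<phi> h \<longleftrightarrow>
     \<delta> > 0 \<and> positively_homogeneous_on D \<delta> h \<and>
     (\<exists>e. continuous_on D e \<and> (\<forall>x\<in>D. \<phi> x = h x + e x) \<and>
          ((\<lambda>x. e x /\<^sub>R (norm x powr \<delta>)) \<longlongrightarrow> 0) (inf at_infinity (principal D)))"


section \<open>Generalized variational inequalities and complementarity problems\<close>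

text \<open>In this section \<open>D\<close> is the domain of the first mapping.\<close>

definition SOL :: "'a::real_inner set \<Rightarrow> ('a \<Rightarrow> 'a) \<Rightarrow> ('a \<Rightarrow> 'a) \<Rightarrow> 'a set \<Rightarrow> 'a set" where
  "SOL D \<phi> \<psi> S = {x \<in> D. \<psi> x \<in> S \<and> (\<forall>y\<in>S. \<phi> x \<bullet> (y - \<psi> x) \<ge> 0)}"

definition GCP_SOL :: "'a::real_inner set \<Rightarrow> ('a \<Rightarrow> 'a) \<Rightarrow> ('a \<Rightarrow> 'a) \<Rightarrow> 'a set \<Rightarrow> 'a set" where
  "GCP_SOL D \<phi> \<psi> S = {x \<in> D. \<psi> x \<in> S \<and> \<phi> x \<in> dual_cone S \<and> \<phi> x \<bullet> \<psi> x = 0}"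

definition strictly_monotone_wrt ::
    "'a::real_inner set \<Rightarrow> ('a \<Rightarrow> 'a) \<Rightarrow> ('a \<Rightarrow> 'a) \<Rightarrow> 'a set \<Rightarrow> bool" where
  "strictly_monotone_wrt D \<phi> \<psi> S \<longleftrightarrow>
     (\<forall>x\<in>D. \<forall>y\<in>D. \<psi> x \<in> S \<and> \<psi> y \<in> S \<and> x \<noteq> y \<longrightarrow> (\<phi> x - \<phi> y) \<bullet> (\<psi> x - \<psi> y) > 0)"

definition natural_map ::
    "('a::euclidean_space \<Rightarrow> 'a) \<Rightarrow> ('a \<Rightarrow> 'a) \<Rightarrow> 'a set \<Rightarrow> 'a \<Rightarrow> 'a" where
  "natural_map \<phi> \<psi> S x = \<psi> x - closest_point S (\<psi> x - \<phi> x)"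

end

(*
  Uniqueness is immediate from strict monotonicity. For existence, deform K into its recession cone
  through the sets t K + K_inf and (f, g) into (f_inf, g_inf) linearly; the natural maps of these
  problems form a homotopy. Its zeros stay bounded: normalising an unbounded sequence of zeros gives
  in the limit a nonzero element of SOL(f_inf, g_inf, K_inf). If the problem for K had no solution,
  the homotopy would end in a map without zeros, so the index at 0 of the natural map of
  (f_inf, g_inf, K_inf) would vanish. The complementarity problem is the case where K is replaced
  by the cone K_inf, which is its own recession cone.
*)

theory Submission
  imports Defs
begin

section \<open>Vanishing of the index\<close>

text \<open>The degree requires maps on the whole space, whereas \<open>f\<close> is controlled only
  on \<open>C\<close>: elsewhere the extensions \<open>F\<close> and \<open>Finf\<close> are
  arbitrary, without any growth bound. The obstacle is therefore to show that every zero that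
  matters lies in \<open>C\<close>. This is where the two assumptions on \<open>g\<close> enter: at
  a far zero the deformed \<open>g\<close> has its value in \<open>C\<close>, and adding a
  nonnegative multiple of \<open>g x - ginf x\<close>, again in \<open>C\<close>, restores
  \<open>g x\<close> itself. The two degrees of homogeneity may differ, so the deformed
  \<open>f\<close> and \<open>g\<close> are normalised by different powers of the norm; the set,
  which constrains \<open>g\<close>, is rescaled with the power belonging to \<open>g\<close>.
  Arguing by contradiction reduces the degree theory to one statement, that the index is 0 if the
  homotopy ends in a map without zeros. It is read off the homological definition.\<close>

lemma homotopic_with_euclidean:
  fixes f g :: "'a::euclidean_space \<Rightarrow> 'a"
  assumes "continuous_on ({0..1::real} \<times> UNIV) h"
    and "\<And>x. h (0, x) = f x" "\<And>x. h (1, x) = g x"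
    and "\<And>t. t \<in> {0..1} \<Longrightarrow> P (\<lambda>x. h (t, x))"
  shows "homotopic_with P euclidean euclidean f g"
proof -
  have "prod_topology (top_of_set {0..1::real}) (euclidean :: 'a topology) = top_of_set ({0..1} \<times> UNIV)"
    by (metis prod_topology_subtopology_eu subtopology_UNIV)
  then show ?thesis
    unfolding homotopic_with_def using assms by (auto intro!: exI[where x = h])
qed

text \<open>Contractibility of the whole space shifts the group to the reduced homology of the
  punctured space one degree lower, and the punctured space is homotopy equivalent to the unit
  sphere. The purpose is a class of infinite order, which makes the exponent in
  \<open>is_brouwer_degree\<close> unique.\<close>

lemma relative_homology_group_punctured:
  "relative_homology_group (int DIM('a)) euclidean (- {0::'a::euclidean_space}) \<cong> integer_group"
proof -
  let ?n = "DIM('a)" and ?S = "sphere (0::'a) 1"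
  have "contractible_space (euclidean :: 'a topology)"
    by (metis contractible_space_top_of_set convex_UNIV convex_imp_contractible subtopology_UNIV)
  moreover obtain b :: 'a where "b \<in> Basis"
    using nonempty_Basis by blast
  ultimately have "relative_homology_group (int ?n) euclidean (- {0::'a})
      \<cong> reduced_homology_group (int ?n - 1) (top_of_set (- {0::'a}))"
    by (intro isomorphic_group_relative_homology_of_contractible) (auto intro!: exI[of _ b])
  also have "\<dots> \<cong> reduced_homology_group (int ?n - 1) (top_of_set ?S)"
  proof (rule homotopy_equivalent_space_imp_isomorphic_reduced_homology_groups)
    have "affine hull cball (0::'a) 1 - {0} = - {0}"
      by (metis Compl_eq_Diff_UNIV aff_dim_cball aff_dim_lt_full not_less_iff_gr_or_eq zero_less_one)
    then have "?S homotopy_eqv - {0::'a}"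
      using homotopy_eqv_rel_frontier_punctured_affine_hull [of "cball (0::'a) 1" 0]
      by (simp add: rel_interior_nonempty_interior)
    then show "top_of_set (- {0::'a}) homotopy_equivalent_space top_of_set ?S"
      using homotopy_equivalent_space_sym by blast
  qed
  also have "\<dots> \<cong> reduced_homology_group (int ?n - 1) (nsphere (?n - 1))"
  proof (rule homeomorphic_space_imp_isomorphic_reduced_homology_groups)
    obtain f :: "(nat \<Rightarrow> real) \<Rightarrow> 'a" and g
      where "homeomorphic_maps (nsphere (?n - 1)) (top_of_set (?S \<inter> span Basis)) f g"
      using homeomorphic_maps_nsphere_euclidean_sphere
        [OF independent_Basis orthogonal_Basis refl _ norm_Basis] by auto
    then show "top_of_set ?S homeomorphic_space nsphere (?n - 1)"
      by (metis Int_UNIV_right homeomorphic_space_def homeomorphic_space_sym span_Basis)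
  qed
  also have "\<dots> \<cong> integer_group"
    using reduced_homology_group_nsphere(1)[of "?n - 1"] DIM_positive[where 'a='a]
    by (simp add: of_nat_diff)
  finally show ?thesis .
qed

lemma iso_imp_surj:
  assumes "h \<in> iso G H" "c \<in> carrier H"
  obtains a where "a \<in> carrier G" "h a = c"
proof -
  have "c \<in> h ` carrier G"
    using assms by (simp add: iso_def bij_betw_def)
  then show thesis
    using that by blast
qed

lemma iso_integer_group_obtain_infinite_order:
  assumes "group G" "G \<cong> integer_group"
  obtains c where "c \<in> carrier G" "\<And>d::int. c [^]\<^bsub>G\<^esub> d = \<one>\<^bsub>G\<^esub> \<Longrightarrow> d = 0"
proof -
  obtain h where h: "h \<in> iso G integer_group"
    using assms(2) by (auto simp: is_iso_def)
  then obtain c where c: "c \<in> carrier G" "h c = 1"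
    by (auto simp: iso_def bij_betw_def image_iff set_eq_iff) metis
  interpret group_hom G integer_group h
    using h assms(1) by (simp add: group_hom_def group_hom_axioms_def iso_def)
  have "d = 0" if "c [^]\<^bsub>G\<^esub> d = \<one>\<^bsub>G\<^esub>" for d :: int
  proof -
    have "h (c [^]\<^bsub>G\<^esub> d) = 1 [^]\<^bsub>integer_group\<^esub> d"
      using c by (simp add: hom_int_pow)
    then show ?thesis
      using that by simp
  qed
  with c that show thesis by blast
qed

text \<open>In the long exact sequence of the triple (whole space, complement of \<open>0\<close>,
  complement of the ball) both groups next to this map vanish, because the punctured space can be
  pushed into the complement of the ball.\<close>

lemma hom_induced_complement_cball_iso:
  assumes "r \<ge> 0"
  shows "hom_induced p euclidean (- cball 0 r) euclidean (- {0::'a::euclidean_space}) id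
    \<in> iso (relative_homology_group p euclidean (- cball 0 r))
          (relative_homology_group p euclidean (- {0::'a}))"
proof (rule very_short_exact_sequence)
  let ?S = "- {0::'a}" and ?T = "- cball (0::'a) r"
  have TS: "?T \<subseteq> ?S"
    using assms by auto
  show "exact_seq
         ([relative_homology_group (p - 1) (top_of_set ?S) ?T, relative_homology_group p euclidean ?S,
           relative_homology_group p euclidean ?T, relative_homology_group p (top_of_set ?S) ?T],
          [hom_relboundary p euclidean ?S ?T, hom_induced p euclidean ?T euclidean ?S id,
           hom_induced p (top_of_set ?S) ?T euclidean ?T id])"
    using homology_exactness_triple_1 [OF TS] homology_exactness_triple_3 [OF TS] by fastforce
  have "trivial_group (relative_homology_group q (top_of_set ?S) ?T)" for q
  proof (rule trivial_relative_homology_group_alt)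
    \<comment> \<open>\<open>?f s\<close> moves each nonzero point outward along its ray by
      \<open>s * r\<close>. At \<open>s = 1\<close> all norms exceed \<open>r\<close>, and points
      outside the ball stay outside at every time, as a homotopy of pairs requires.\<close>
    let ?f = "\<lambda>s x::'a. (1 + s * r / norm x) *\<^sub>R x"
    have norm_f: "norm (?f s x) = norm x + s * r" if "x \<noteq> 0" "0 \<le> s" for x s
    proof -
      have "norm (?f s x) = (1 + s * r / norm x) * norm x"
        using assms that by simp
      also have "\<dots> = norm x + s * r"
        using that by (simp add: algebra_simps)
      finally show ?thesis .
    qed
    have "continuous_on ?S (?f 1)"
      by (intro continuous_intros) auto
    moreover have "?f 1 x \<in> ?S \<inter> ?T" if "x \<in> ?S" for x
    proof -
      have "norm (?f 1 x) = norm x + r" "norm x > 0"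
        using norm_f[of x 1] that by auto
      then have "norm (?f 1 x) > r" "norm (?f 1 x) \<noteq> 0"
        using assms by linarith+
      then show ?thesis
        by (metis ComplI IntI mem_cball_0 norm_zero not_less singletonD)
    qed
    ultimately show "continuous_map (top_of_set ?S) (subtopology (top_of_set ?S) ?T) (?f 1)"
      by (simp add: subtopology_subtopology image_subset_iff Pi_iff)
    have "homotopic_with (\<lambda>k. k ` ?T \<subseteq> ?T) (top_of_set ?S) (top_of_set ?S) id (?f 1)"
      unfolding homotopic_with_def
    proof (intro exI[of _ "\<lambda>z. ?f (fst z) (snd z)"] conjI allI ballI)
      have "continuous_on ({0..1} \<times> ?S) (\<lambda>z. ?f (fst z) (snd z))"
        by (intro continuous_intros) auto
      moreover have "?f t x \<in> ?S" if "t \<in> {0..1}" "x \<in> ?S" for t x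
        using norm_f[of x t] assms that
        by (metis ComplD ComplI add.right_neutral add_nonneg_eq_0_iff atLeastAtMost_iff insert_iff
            mult_nonneg_nonneg norm_eq_zero norm_ge_zero singletonD)
      ultimately show "continuous_map (prod_topology (top_of_set {0..1}) (top_of_set ?S))
          (top_of_set ?S) (\<lambda>z. ?f (fst z) (snd z))"
        by (auto simp: image_subset_iff Pi_iff)
      fix t :: real assume t: "t \<in> {0..1}"
      have "?f t x \<in> ?T" if "x \<in> ?T" for x
      proof -
        have "x \<noteq> 0" "norm x > r"
          using that assms by auto
        moreover have "t * r \<ge> 0"
          using t assms by simp
        ultimately show ?thesis
          using norm_f[of x t] t by simp
      qed
      then show "(\<lambda>x. ?f (fst (t, x)) (snd (t, x))) ` ?T \<subseteq> ?T"
        by (simp add: image_subset_iff)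
    qed auto
    then show "homotopic_with (\<lambda>k. k ` ?T \<subseteq> ?T) (top_of_set ?S) (top_of_set ?S) (?f 1) id"
      by (rule homotopic_with_symD)
  qed
  then show "trivial_group (relative_homology_group p (top_of_set ?S) ?T)"
    "trivial_group (relative_homology_group (p - 1) (top_of_set ?S) ?T)"
    by auto
qed

text \<open>Excision of the complement of \<open>\<Omega>\<close>, a closed set inside the open set
  \<open>- {0}\<close>.\<close>

lemma hom_induced_open_excision_iso:
  assumes "open \<Omega>" "(0::'a::euclidean_space) \<in> \<Omega>"
  shows "hom_induced p (top_of_set \<Omega>) (\<Omega> - {0}) euclidean (- {0}) id
    \<in> iso (relative_homology_group p (top_of_set \<Omega>) (\<Omega> - {0}))
          (relative_homology_group p euclidean (- {0}))"
proof -
  have "closure (- \<Omega>) \<subseteq> interior (- {0::'a})"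
    using assms by (simp add: closed_Compl interior_open open_Compl)
  then have "hom_induced p (subtopology euclidean (UNIV - (- \<Omega>))) (- {0} - (- \<Omega>))
         (subtopology euclidean UNIV) (- {0}) id
    \<in> iso (relative_homology_group p (subtopology euclidean (UNIV - (- \<Omega>))) (- {0} - (- \<Omega>)))
          (relative_homology_group p (subtopology euclidean UNIV) (- {0}))"
    by (intro homology_excision_axiom) auto
  moreover have "- {0} - (- \<Omega>) = \<Omega> - {0}" "UNIV - (- \<Omega>) = \<Omega>"
    by auto
  ultimately show ?thesis
    by simp
qed

text \<open>By naturality \<open>\<phi>\<close> sends a local class \<open>a\<close> to the same
  element as a matching class \<open>b\<close> of the pair formed with the complement of a ball, and
  there \<open>\<phi>\<close> is homotopic to a map without zeros. So every degree equation has the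
  unit on its left side.\<close>

lemma brouwer_index_eq_0:
  fixes H :: "real \<times> 'a::euclidean_space \<Rightarrow> 'a"
  assumes cont: "continuous_on ({0..1} \<times> UNIV) H"
    and zero_iff: "\<And>x. H (0, x) = 0 \<longleftrightarrow> x = 0"
    and bounded: "\<And>t x. \<lbrakk>t \<in> {0..1}; norm x > R\<rbrakk> \<Longrightarrow> H (t, x) \<noteq> 0"
    and nonzero: "\<And>x. H (1, x) \<noteq> 0"
  shows "brouwer_index (\<lambda>x. H (0, x)) 0 = 0"
proof -
  define n where "n = int DIM('a)"
  define \<phi> where "\<phi> = (\<lambda>x. H (0, x))"
  define \<psi> where "\<psi> = (\<lambda>x. H (1, x))"
  have cont_slice: "continuous_on UNIV (\<lambda>x. H (t, x))" if "t \<in> {0..1}" for t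
    by (rule continuous_on_compose2[OF cont]) (use that in \<open>auto intro!: continuous_intros\<close>)
  have cont_\<phi>: "continuous_on UNIV \<phi>" and cont_\<psi>: "continuous_on UNIV \<psi>"
    using cont_slice[of 0] cont_slice[of 1] by (auto simp: \<phi>_def \<psi>_def)
  have \<phi>_zero: "\<phi> x = 0 \<longleftrightarrow> x = 0" for x
    by (simp add: \<phi>_def zero_iff)
  \<comment> \<open>Stretching by \<open>s\<close> moves the complement of \<open>cball 0 r\<close> beyond all zeros of \<open>H\<close>; there \<open>\<phi>\<close>
    deforms into \<open>\<psi>\<close>, which factors through the trivial group of the pair \<open>(UNIV, UNIV)\<close>.\<close>
  have trivial: "hom_induced n euclidean (- cball 0 r) euclidean (- {0}) \<phi> b
      = \<one>\<^bsub>relative_homology_group n euclidean (- {0})\<^esub>"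
    if "r > 0" for r b
  proof -
    \<comment> \<open>A norm above \<open>r\<close> is stretched to one above
      \<open>r + \<bar>R\<bar>\<close>; the absolute value allows for a negative
      \<open>R\<close>.\<close>
    define s where "s = 1 + \<bar>R\<bar> / r"
    have s: "s \<ge> 1"
      using \<open>r > 0\<close> by (simp add: s_def)
    have norm_s: "norm (s *\<^sub>R x) > R" if "x \<in> - cball 0 r" for x :: 'a
    proof -
      have "norm x > r"
        using that by simp
      then have "\<bar>R\<bar> / r * r \<le> \<bar>R\<bar> / r * norm x"
        using \<open>r > 0\<close> by (intro mult_left_mono) auto
      moreover have "norm (s *\<^sub>R x) = norm x + \<bar>R\<bar> / r * norm x"
        using s by (simp add: s_def distrib_right)
      ultimately show ?thesis
        using \<open>norm x > r\<close> \<open>r > 0\<close> by simp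
    qed
    \<comment> \<open>Only the complement of the ball has to avoid \<open>0\<close> during the
      homotopies, so zeros inside the ball do no harm. The first homotopy rescales the argument by
      positive factors, which is safe as \<open>\<phi>\<close> vanishes only at \<open>0\<close>;
      the second is \<open>H\<close> itself.\<close>
    have "hom_induced n euclidean (- cball 0 r) euclidean (- {0}) \<phi>
        = hom_induced n euclidean (- cball 0 r) euclidean (- {0}) (\<lambda>x. \<phi> (s *\<^sub>R x))"
    proof (intro homology_homotopy_axiom homotopic_with_euclidean)
      show "continuous_on ({0..1::real} \<times> UNIV) (\<lambda>z. \<phi> ((1 + fst z * (s - 1)) *\<^sub>R snd z))"
        by (intro continuous_on_compose2[OF cont_\<phi>] continuous_intros) auto
      fix t :: real assume t: "t \<in> {0..1}"
      have "1 + t * (s - 1) > 0"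
        using t s by (simp add: add_pos_nonneg)
      then show "(\<lambda>x. \<phi> ((1 + fst (t, x) * (s - 1)) *\<^sub>R snd (t, x))) \<in> - cball 0 r \<rightarrow> - {0}"
        using \<open>r > 0\<close> by (auto simp: \<phi>_zero)
    qed auto
    also have "\<dots> = hom_induced n euclidean (- cball 0 r) euclidean (- {0}) (\<lambda>x. \<psi> (s *\<^sub>R x))"
    proof (intro homology_homotopy_axiom homotopic_with_euclidean)
      show "continuous_on ({0..1::real} \<times> UNIV) (\<lambda>z. H (fst z, s *\<^sub>R snd z))"
        by (intro continuous_on_compose2[OF cont] continuous_intros) auto
      fix t :: real assume t: "t \<in> {0..1}"
      show "(\<lambda>x. H (fst (t, x), s *\<^sub>R snd (t, x))) \<in> - cball 0 r \<rightarrow> - {0}"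
        using bounded[OF t] norm_s by simp
    qed (auto simp: \<phi>_def \<psi>_def)
    also have "\<dots> = hom_induced n euclidean UNIV euclidean (- {0}) (\<lambda>x. \<psi> (s *\<^sub>R x)) \<circ>
        hom_induced n euclidean (- cball 0 r) euclidean UNIV id"
    proof -
      have "continuous_on UNIV (\<lambda>x. \<psi> (s *\<^sub>R x))"
        by (intro continuous_on_compose2[OF cont_\<psi>] continuous_intros) auto
      then show ?thesis
        using nonzero
        by (subst hom_induced_compose[symmetric]) (auto simp: \<psi>_def)
    qed
    finally have "hom_induced n euclidean (- cball 0 r) euclidean (- {0}) \<phi> b
      = hom_induced n euclidean UNIV euclidean (- {0}) (\<lambda>x. \<psi> (s *\<^sub>R x))
          (hom_induced n euclidean (- cball 0 r) euclidean UNIV id b)"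
      by simp
    moreover have "hom_induced n euclidean (- cball 0 r) euclidean UNIV id b
        = \<one>\<^bsub>relative_homology_group n (euclidean :: 'a topology) UNIV\<^esub>"
      using trivial_relative_homology_group_topspace[of n "euclidean :: 'a topology"]
        hom_induced_carrier[of n euclidean "- cball 0 r" euclidean "UNIV :: 'a set" id b]
      by (auto simp: trivial_group_def)
    ultimately show ?thesis
      by (simp add: hom_one[OF hom_induced_hom])
  qed
  have degree: "brouwer_degree \<phi> \<Omega> 0 = 0" if iso: "isolating \<phi> 0 \<Omega>" for \<Omega>
  proof -
    have \<Omega>: "open \<Omega>" "bounded \<Omega>" "0 \<in> \<Omega>"
      using iso by (auto simp: isolating_def)
    have Z: "{x \<in> \<Omega>. \<phi> x = 0} = {0}"
      using \<Omega> by (auto simp: \<phi>_zero)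
    let ?P = "relative_homology_group n euclidean (- {0::'a})"
    let ?i = "hom_induced n (top_of_set \<Omega>) (\<Omega> - {0}) euclidean (- {0}) id"
    let ?j = "\<lambda>r. hom_induced n euclidean (- cball (0::'a) r) euclidean (- {0}) id"
    have \<phi>_i: "hom_induced n (top_of_set \<Omega>) (\<Omega> - {0}) euclidean (- {0}) \<phi> a = \<one>\<^bsub>?P\<^esub>"
      if "r > 0" "?i a = ?j r b" for a b r
    proof -
      have "hom_induced n (top_of_set \<Omega>) (\<Omega> - {0}) euclidean (- {0}) (\<phi> \<circ> id) a
          = hom_induced n euclidean (- {0}) euclidean (- {0}) \<phi> (?i a)"
        using cont_\<phi> by (subst hom_induced_compose) (auto simp: \<phi>_zero)
      also have "\<dots> = hom_induced n euclidean (- {0}) euclidean (- {0}) \<phi> (?j r b)"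
        using that by simp
      also have "\<dots> = hom_induced n euclidean (- cball 0 r) euclidean (- {0}) (\<phi> \<circ> id) b"
        using cont_\<phi> \<open>r > 0\<close> by (subst hom_induced_compose) (auto simp: \<phi>_zero)
      also have "\<dots> = \<one>\<^bsub>?P\<^esub>"
        using trivial[OF \<open>r > 0\<close>] by simp
      finally show ?thesis
        by simp
    qed
    obtain r where r: "r > 0" "\<Omega> \<subseteq> cball 0 r"
      using \<Omega>(2) bounded_subset_ballD[of \<Omega> 0] ball_subset_cball by (metis order_trans)
    \<comment> \<open>\<open>THE\<close> demands existence as well as uniqueness, hence an
      equivalence.\<close>
    have "is_brouwer_degree \<phi> \<Omega> 0 d \<longleftrightarrow> d = 0" for d
    proof
      assume d: "is_brouwer_degree \<phi> \<Omega> 0 d"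
      \<comment> \<open>\<open>a\<close> and \<open>b\<close> are chosen over the same
        \<open>c\<close>, so they form a matching pair for the definition; \<open>\<phi>_i\<close>
        then makes \<open>c\<close> to the power \<open>d\<close> the unit.\<close>
      obtain c where c: "c \<in> carrier ?P" "\<And>d::int. c [^]\<^bsub>?P\<^esub> d = \<one>\<^bsub>?P\<^esub> \<Longrightarrow> d = 0"
        using iso_integer_group_obtain_infinite_order relative_homology_group_punctured
        by (metis group_relative_homology_group n_def)
      obtain a where a: "a \<in> carrier (relative_homology_group n (top_of_set \<Omega>) (\<Omega> - {0}))" "?i a = c"
        using iso_imp_surj[OF hom_induced_open_excision_iso[OF \<Omega>(1,3)] c(1)] by blast
      obtain b where b: "b \<in> carrier (relative_homology_group n euclidean (- cball (0::'a) r))" "?j r b = c"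
        using iso_imp_surj[OF hom_induced_complement_cball_iso[OF less_imp_le[OF r(1)]] c(1)]
        by blast
      have "hom_induced n (top_of_set \<Omega>) (\<Omega> - {0}) euclidean (- {0}) \<phi> a = c [^]\<^bsub>?P\<^esub> d"
        using d[unfolded is_brouwer_degree_def Let_def Z, folded n_def, rule_format, of r a b] a b r
        by simp
      then show "d = 0"
        using \<phi>_i[of r a b] r a b c(2) by simp
    next
      assume "d = 0"
      \<comment> \<open>The definition ranges over all radii, while \<open>\<phi>_i\<close> covers
        positive ones. A ball containing a neighbourhood of \<open>0\<close> has positive
        radius.\<close>
      have "r' > 0" if "\<Omega> \<subseteq> cball 0 r'" for r'
      proof -
        have "0 \<in> interior (cball (0::'a) r')"
          using \<Omega> that by (meson interior_maximal subsetD)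
        then show ?thesis
          by simp
      qed
      with \<phi>_i show "is_brouwer_degree \<phi> \<Omega> 0 d"
        unfolding is_brouwer_degree_def Let_def Z n_def[symmetric] \<open>d = 0\<close>
        by auto
    qed
    then show ?thesis
      by (simp add: brouwer_degree_def)
  qed
  \<comment> \<open>Some isolating set must exist, for otherwise every \<open>d\<close> would meet
    the condition in \<open>brouwer_index\<close>.\<close>
  have "isolating \<phi> 0 (ball 0 1)"
    by (auto simp: isolating_def \<phi>_zero)
  then have "(\<forall>\<Omega>. isolating \<phi> 0 \<Omega> \<longrightarrow> brouwer_degree \<phi> \<Omega> 0 = d) \<longleftrightarrow> d = 0" for d
    using degree by metis
  then show ?thesis
    by (simp add: brouwer_index_def \<phi>_def)
qed


section \<open>Recession cones and their projections\<close>

text \<open>Convex combinations of \<open>k\<close> and \<open>x n\<close> with weights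
  \<open>1 - c / t n\<close> and \<open>c / t n\<close> lie in \<open>K\<close> for large
  \<open>n\<close> and tend to \<open>k + c *\<^sub>R u\<close>. The half-line condition, at one
  base point of free choice, replaces sequences by algebra in what follows.\<close>

lemma recession_cone_iff:
  fixes K :: "'a::euclidean_space set"
  assumes K: "closed K" "convex K" and k: "k \<in> K"
  shows "u \<in> recession_cone K \<longleftrightarrow> (\<forall>c\<ge>0. k + c *\<^sub>R u \<in> K)"
proof
  assume "u \<in> recession_cone K"
  then obtain t :: "nat \<Rightarrow> real" and x where t: "filterlim t at_top sequentially"
    and x: "\<And>n. x n \<in> K" and lim: "(\<lambda>n. x n /\<^sub>R t n) \<longlonglongrightarrow> u"
    by (auto simp: recession_cone_def)
  show "\<forall>c\<ge>0. k + c *\<^sub>R u \<in> K"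
  proof (intro allI impI)
    fix c :: real assume c: "c \<ge> 0"
    have "(\<lambda>n. inverse (t n)) \<longlonglongrightarrow> 0"
      using t by (rule tendsto_inverse_0_at_top)
    then have "(\<lambda>n. (1 - c * inverse (t n)) *\<^sub>R k + c *\<^sub>R (x n /\<^sub>R t n)) \<longlonglongrightarrow> (1 - c * 0) *\<^sub>R k + c *\<^sub>R u"
      by (intro tendsto_intros lim)
    moreover have "\<forall>\<^sub>F n in sequentially. (1 - c * inverse (t n)) *\<^sub>R k + c *\<^sub>R (x n /\<^sub>R t n) \<in> K"
    proof -
      have "\<forall>\<^sub>F n in sequentially. t n \<ge> max 1 c"
        using t unfolding filterlim_at_top by blast
      then show ?thesis
      proof eventually_elim
        case (elim n)
        then have "c * inverse (t n) \<le> 1" "0 \<le> c * inverse (t n)"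
          using c by (auto simp: field_simps)
        then have "(1 - c * inverse (t n)) *\<^sub>R k + (c * inverse (t n)) *\<^sub>R x n \<in> K"
          using K(2) k x by (intro convexD) auto
        then show ?case by simp
      qed
    qed
    ultimately have "(1 - c * 0) *\<^sub>R k + c *\<^sub>R u \<in> K"
      by (intro Lim_in_closed_set[OF K(1) _ trivial_limit_sequentially])
    then show "k + c *\<^sub>R u \<in> K"
      by simp
  qed
next
  assume u: "\<forall>c\<ge>0. k + c *\<^sub>R u \<in> K"
  have "(\<lambda>n. inverse (real (Suc n)) *\<^sub>R k + u) \<longlonglongrightarrow> 0 *\<^sub>R k + u"
    by (intro tendsto_intros LIMSEQ_inverse_real_of_nat)
  moreover have "(k + real (Suc n) *\<^sub>R u) /\<^sub>R real (Suc n) = inverse (real (Suc n)) *\<^sub>R k + u" for n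
    by (simp add: scaleR_add_right del: of_nat_Suc)
  ultimately have "(\<lambda>n. (k + real (Suc n) *\<^sub>R u) /\<^sub>R real (Suc n)) \<longlonglongrightarrow> u"
    by simp
  moreover have "filterlim (\<lambda>n. real (Suc n)) at_top sequentially"
    by (rule filterlim_compose[OF filterlim_real_sequentially filterlim_Suc])
  ultimately show "u \<in> recession_cone K"
    using u unfolding recession_cone_def
    by (intro CollectI exI[of _ "\<lambda>n. real (Suc n)"] exI[of _ "\<lambda>n. k + real (Suc n) *\<^sub>R u"]) auto
qed

context
  fixes K :: "'a::euclidean_space set"
  assumes K: "K \<noteq> {}" "closed K" "convex K"
begin

lemma zero_mem_recession_cone: "0 \<in> recession_cone K"
  using K recession_cone_iff by fastforce

lemma add_mem_recession_cone:
  assumes "k \<in> K" "u \<in> recession_cone K" "c \<ge> 0"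
  shows "k + c *\<^sub>R u \<in> K"
  using recession_cone_iff[OF K(2,3) assms(1)] assms by simp

lemma closed_recession_cone: "closed (recession_cone K)"
proof -
  obtain k where k: "k \<in> K"
    using K by auto
  have "recession_cone K = (\<Inter>c\<in>{0..}. (\<lambda>u. k + c *\<^sub>R u) -` K)"
    using recession_cone_iff[OF K(2,3) k] by auto
  moreover have "closed ((\<lambda>u. k + c *\<^sub>R u) -` K)" for c
    by (intro continuous_closed_vimage K continuous_intros)
  ultimately show ?thesis
    by auto
qed

lemma convex_cone_recession_cone: "convex_cone (recession_cone K)"
proof -
  obtain k where k: "k \<in> K"
    using K by auto
  note iff = recession_cone_iff[OF K(2,3) k]
  have "x + y \<in> recession_cone K" if "x \<in> recession_cone K" "y \<in> recession_cone K" for x y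
    unfolding iff
  proof (intro allI impI)
    fix c :: real assume c: "c \<ge> 0"
    show "k + c *\<^sub>R (x + y) \<in> K"
      using add_mem_recession_cone[OF add_mem_recession_cone[OF k that(1) c] that(2) c]
      by (simp add: algebra_simps)
  qed
  moreover have "c *\<^sub>R x \<in> recession_cone K" if "x \<in> recession_cone K" "c \<ge> 0" for x c
    using that unfolding iff by simp
  ultimately show ?thesis
    using zero_mem_recession_cone by (auto simp: convex_cone_iff)
qed

lemma recession_cone_subset:
  assumes "closed C" "convex_cone C" "K \<subseteq> C"
  shows "recession_cone K \<subseteq> C"
proof
  fix u assume "u \<in> recession_cone K"
  moreover obtain k where k: "k \<in> K"
    using K by auto
  ultimately have "k + c *\<^sub>R u \<in> C" if "c \<ge> 0" for c
    using add_mem_recession_cone that assms by blast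
  \<comment> \<open>The base point moves from \<open>k\<close> to \<open>0\<close>: the half-line
    criterion for \<open>C\<close> may be read at either.\<close>
  then have "\<forall>c\<ge>0. 0 + c *\<^sub>R u \<in> C"
    using recession_cone_iff assms k convex_cone_contains_0
    by (metis convex_cone_def subsetD)
  then show "u \<in> C"
    by (auto dest: spec[of _ 1])
qed

end

lemma recession_cone_cone:
  fixes C :: "'a::euclidean_space set"
  assumes "closed C" "convex_cone C"
  shows "recession_cone C = C"
proof -
  have "u \<in> recession_cone C \<longleftrightarrow> (\<forall>c\<ge>0. c *\<^sub>R u \<in> C)" for u
    using assms recession_cone_iff[of C 0] convex_cone_contains_0[of C]
    by (simp add: convex_cone_def)
  also have "\<dots> u \<longleftrightarrow> u \<in> C" for u
    using convex_cone_scaleR[OF assms(2)] by (metis scaleR_one zero_le_one)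
  finally show ?thesis
    by blast
qed

section \<open>Interpolation between a convex set and its recession cone\<close>

text \<open>Adding the recession cone changes nothing for \<open>t > 0\<close> and makes the family continuous at \<open>t = 0\<close>.\<close>

definition scaled_sum :: "'a::real_normed_vector set \<Rightarrow> real \<Rightarrow> 'a set" where
  "scaled_sum K t = {t *\<^sub>R k + u |k u. k \<in> K \<and> u \<in> recession_cone K}"

context
  fixes K :: "'a::euclidean_space set"
  assumes K: "K \<noteq> {}" "closed K" "convex K"
begin

lemma scaled_sum_0: "scaled_sum K 0 = recession_cone K"
  using K by (auto simp: scaled_sum_def)

lemma scaled_sum_1: "scaled_sum K 1 = K"
  using add_mem_recession_cone[OF K, of _ _ 1] zero_mem_recession_cone[OF K]
  by (force simp: scaled_sum_def)

lemma scaled_sum_nonempty: "scaled_sum K t \<noteq> {}"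
  using K zero_mem_recession_cone[OF K] by (auto simp: scaled_sum_def)

lemma scaled_sum_subset_cone:
  assumes "closed C" "convex_cone C" "K \<subseteq> C" "t \<ge> 0"
  shows "scaled_sum K t \<subseteq> C"
  using recession_cone_subset[OF K assms(1-3)] assms
  by (auto simp: scaled_sum_def intro!: convex_cone_add convex_cone_scaleR)

lemma scaleR_mem_scaled_sum:
  assumes "y \<in> scaled_sum K t" "c \<ge> 0"
  shows "c *\<^sub>R y \<in> scaled_sum K (c * t)"
proof -
  obtain k u where "y = t *\<^sub>R k + u" "k \<in> K" "u \<in> recession_cone K"
    using assms by (auto simp: scaled_sum_def)
  moreover from this have "c *\<^sub>R u \<in> recession_cone K"
    using convex_cone_scaleR[OF convex_cone_recession_cone[OF K] assms(2)] by simp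
  moreover have "c *\<^sub>R (t *\<^sub>R k + u) = (c * t) *\<^sub>R k + c *\<^sub>R u"
    by (simp add: scaleR_add_right)
  ultimately show ?thesis
    unfolding scaled_sum_def by blast
qed

lemma convex_scaled_sum: "convex (scaled_sum K t)"
proof -
  have "scaled_sum K t = (\<Union>x\<in>(*\<^sub>R) t ` K. \<Union>y\<in>recession_cone K. {x + y})"
    by (auto simp: scaled_sum_def)
  then show ?thesis
    using convex_sums[OF convex_scaling[OF K(3), of t], of "recession_cone K"]
      convex_cone_recession_cone[OF K] by (simp add: convex_cone_def)
qed

text \<open>The summands \<open>k n\<close> and \<open>u n\<close> may be unbounded, so only
  \<open>y n\<close> is passed to the limit. If \<open>t' > 0\<close>, division by
  \<open>t n\<close> puts \<open>y n\<close> into \<open>K\<close>, which absorbs the recession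
  part. If \<open>t' = 0\<close>, convex combinations with a fixed \<open>k0\<close> exhibit
  \<open>y'\<close> as a recession direction. Closedness jointly in \<open>t\<close> and
  \<open>y\<close> underlies both the continuity of the projections and the limit of the rescaled
  zeros.\<close>

lemma closed_scaled_sum_graph:
  "closed {(t, y). 0 \<le> t \<and> y \<in> scaled_sum K t}"
  unfolding closed_sequential_limits
proof (intro allI impI, elim conjE)
  fix z l assume z: "\<forall>n. z n \<in> {(t, y). 0 \<le> t \<and> y \<in> scaled_sum K t}" and lim: "z \<longlonglongrightarrow> l"
  define t where "t n = fst (z n)" for n
  define y where "y n = snd (z n)" for n
  have t: "t n \<ge> 0" and "y n \<in> scaled_sum K (t n)" for n
    using z by (auto simp: t_def y_def case_prod_beta)
  then have "\<forall>n. \<exists>k u. y n = t n *\<^sub>R k + u \<and> k \<in> K \<and> u \<in> recession_cone K"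
    by (auto simp: scaled_sum_def)
  then obtain k u where ku: "\<And>n. y n = t n *\<^sub>R k n + u n" "\<And>n. k n \<in> K"
      "\<And>n. u n \<in> recession_cone K"
    by metis
  obtain t' y' where l: "l = (t', y')"
    by fastforce
  have limt: "t \<longlonglongrightarrow> t'" and limy: "y \<longlonglongrightarrow> y'"
    using tendsto_fst[OF lim] tendsto_snd[OF lim] by (simp_all add: t_def[abs_def] y_def[abs_def] l)
  have t': "t' \<ge> 0"
    using limt t by (intro LIMSEQ_le_const) auto
  have "y' \<in> scaled_sum K t'"
  proof (cases "t' = 0")
    case True
    obtain k0 where k0: "k0 \<in> K"
      using K by auto
    have "k0 + c *\<^sub>R y' \<in> K" if c: "c \<ge> 0" for c
    proof -
      have "(\<lambda>n. (1 - c * t n) *\<^sub>R k0 + c *\<^sub>R y n) \<longlonglongrightarrow> (1 - c * 0) *\<^sub>R k0 + c *\<^sub>R y'"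
        using limt limy True by (intro tendsto_intros) auto
      moreover have "\<forall>\<^sub>F n in sequentially. (1 - c * t n) *\<^sub>R k0 + c *\<^sub>R y n \<in> K"
      proof -
        have "(\<lambda>n. c * t n) \<longlonglongrightarrow> c * 0"
          using limt True by (intro tendsto_intros) auto
        then have "\<forall>\<^sub>F n in sequentially. c * t n < 1"
          by (intro order_tendstoD) auto
        then show ?thesis
        proof eventually_elim
          case (elim n)
          then have "(1 - c * t n) *\<^sub>R k0 + (c * t n) *\<^sub>R k n \<in> K"
            using K(3) k0 ku(2) c t by (intro convexD) auto
          from add_mem_recession_cone[OF K this ku(3) c, of n] show ?case
            by (simp add: ku(1) algebra_simps)
        qed
      qed
      ultimately have "(1 - c * 0) *\<^sub>R k0 + c *\<^sub>R y' \<in> K"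
        by (intro Lim_in_closed_set[OF K(2) _ trivial_limit_sequentially])
      then show ?thesis
        by simp
    qed
    then show ?thesis
      using True recession_cone_iff[OF K(2,3) k0] by (simp add: scaled_sum_0)
  next
    case False
    then have pos: "\<forall>\<^sub>F n in sequentially. t n > 0"
      using limt t' by (intro order_tendstoD) auto
    have "(\<lambda>n. y n /\<^sub>R t n) \<longlonglongrightarrow> y' /\<^sub>R t'"
      using False by (intro tendsto_intros limt limy) auto
    moreover have "\<forall>\<^sub>F n in sequentially. y n /\<^sub>R t n \<in> K"
      using pos
    proof eventually_elim
      case (elim n)
      then show ?case
        using add_mem_recession_cone[OF K ku(2,3), of "inverse (t n)" n n]
        by (simp add: ku(1) scaleR_add_right)
    qed
    ultimately have "y' /\<^sub>R t' \<in> K"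
      by (intro Lim_in_closed_set[OF K(2) _ trivial_limit_sequentially])
    moreover have "y' = t' *\<^sub>R (y' /\<^sub>R t') + 0"
      using False by simp
    ultimately show ?thesis
      using zero_mem_recession_cone[OF K] unfolding scaled_sum_def by blast
  qed
  then show "l \<in> {(t, y). 0 \<le> t \<and> y \<in> scaled_sum K t}"
    using t' l by simp
qed

lemma closed_scaled_sum:
  assumes "t \<ge> 0"
  shows "closed (scaled_sum K t)"
proof -
  have "closed ((\<lambda>y. (t, y)) -` {(t, y). 0 \<le> t \<and> y \<in> scaled_sum K t})"
    by (intro continuous_closed_vimage closed_scaled_sum_graph continuous_intros)
  then show ?thesis
    using assms by (simp add: vimage_def)
qed

text \<open>A map into a compact set is continuous if its graph is closed; local boundedness of the
  projection supplies the compact set.\<close>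

lemma continuous_on_closest_point_scaled_sum:
  "continuous_on ({0..1} \<times> UNIV) (\<lambda>(t, z). closest_point (scaled_sum K t) z)"
proof -
  define P where "P = (\<lambda>(t, z). closest_point (scaled_sum K t) z)"
  obtain k0 where k0: "k0 \<in> K"
    using K by auto
  have scaled_sumI: "t *\<^sub>R k + u \<in> scaled_sum K t"
    if "k \<in> K" "u \<in> recession_cone K" for t k u
    using that by (auto simp: scaled_sum_def)
  note closest = closest_point_in_set[OF closed_scaled_sum scaled_sum_nonempty]
    closest_point_le[OF closed_scaled_sum]
  have local: "continuous_on ({0..1} \<times> cball 0 M) P" for M
  proof (rule continuous_from_closed_graph)
    \<comment> \<open>The point \<open>t *\<^sub>R k0\<close> of the set is within
      \<open>M + norm k0\<close> of \<open>z\<close>, hence so is the projection; passing from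
      \<open>z\<close> to the origin costs another \<open>M\<close>.\<close>
    show "P \<in> {0..1} \<times> cball 0 M \<rightarrow> cball 0 (2 * M + norm k0)"
    proof (clarsimp simp: P_def)
      fix t :: real and z :: 'a
      assume t: "0 \<le> t" "t \<le> 1" and z: "norm z \<le> M"
      let ?y = "closest_point (scaled_sum K t) z"
      have "t *\<^sub>R k0 + 0 \<in> scaled_sum K t"
        using k0 zero_mem_recession_cone[OF K] unfolding scaled_sum_def by blast
      then have "dist z ?y \<le> dist z (t *\<^sub>R k0)"
        using closest(2) t by simp
      also have "\<dots> \<le> norm z + t * norm k0"
        using norm_triangle_ineq4[of z "t *\<^sub>R k0"] t by (simp add: dist_norm)
      also have "\<dots> \<le> M + norm k0"
        using z t by (intro add_mono mult_left_le_one_le) auto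
      finally have "dist z ?y \<le> M + norm k0" .
      moreover have "norm ?y \<le> norm z + dist z ?y"
        by (metis dist_0_norm dist_triangle)
      ultimately show "norm ?y \<le> 2 * M + norm k0"
        using z by linarith
    qed
    \<comment> \<open>The competitors are indexed by \<open>k\<close> and \<open>u\<close>, which do
      not depend on \<open>t\<close>. Minimality of the distance thus becomes an intersection of
      closed conditions although the set moves.\<close>
    have "(\<lambda>x. (x, P x)) ` ({0..1} \<times> cball 0 M)
        = {p. fst (fst p) \<le> 1} \<inter> {p. norm (snd (fst p)) \<le> M}
          \<inter> (\<lambda>p. (fst (fst p), snd p)) -` {(t, y). 0 \<le> t \<and> y \<in> scaled_sum K t}
          \<inter> (\<Inter>k\<in>K. \<Inter>u\<in>recession_cone K.
               {p. dist (snd (fst p)) (snd p) \<le> dist (snd (fst p)) (fst (fst p) *\<^sub>R k + u)})"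
      (is "?L = ?R")
    proof (intro Set.set_eqI iffI)
      fix p assume "p \<in> ?L"
      then show "p \<in> ?R"
        using closest scaled_sumI by (auto simp: P_def)
    next
      fix p assume p: "p \<in> ?R"
      obtain t z y where p_eq: "p = ((t, z), y)"
        by (metis prod.exhaust_sel)
      have "y = closest_point (scaled_sum K t) z"
        using p by (intro closest_point_unique convex_scaled_sum closed_scaled_sum)
          (auto simp: p_eq scaled_sum_def)
      then show "p \<in> ?L"
        using p by (auto simp: p_eq P_def)
    qed
    also have "closed \<dots>"
      by (intro closed_Int closed_INT ballI closed_Collect_le continuous_closed_vimage
          closed_scaled_sum_graph continuous_intros)
    finally show "closed ((\<lambda>x. (x, P x)) ` ({0..1} \<times> cball 0 M))" .
  qed auto
  have "continuous (at x within {0..1} \<times> UNIV) P" if "x \<in> {0..1} \<times> UNIV" for x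
  proof -
    \<comment> \<open>Around \<open>x\<close> the ball of radius \<open>norm (snd x) + 1\<close> is
      a full neighbourhood, so continuity passes from balls to the whole strip.\<close>
    define U where "U = (UNIV :: real set) \<times> ball (0::'a) (norm (snd x) + 1)"
    have "continuous (at x within {0..1} \<times> cball 0 (norm (snd x) + 1)) P"
      using local that by (auto simp: continuous_on_eq_continuous_within)
    moreover have "at x within {0..1} \<times> cball 0 (norm (snd x) + 1) = at x within {0..1} \<times> UNIV"
      by (rule at_within_nhd[of _ U]) (auto simp: U_def open_Times mem_Times_iff)
    ultimately show ?thesis
      by (simp add: continuous_within)
  qed
  then show ?thesis
    unfolding P_def[symmetric] by (simp add: continuous_on_eq_continuous_within)
qed

end

section \<open>Variational inequalities\<close>

text \<open>The obtuse angle criterion for the projection of \<open>\<psi> x - \<phi> x\<close>: the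
  vector from \<open>\<psi> x\<close> to that point is \<open>- \<phi> x\<close>.\<close>

lemma natural_map_eq_0_iff:
  fixes S :: "'a::euclidean_space set"
  assumes S: "S \<noteq> {}" "closed S" "convex S"
  shows "natural_map \<phi> \<psi> S x = 0 \<longleftrightarrow> \<psi> x \<in> S \<and> (\<forall>y\<in>S. \<phi> x \<bullet> (y - \<psi> x) \<ge> 0)"
proof
  assume "natural_map \<phi> \<psi> S x = 0"
  then have eq: "closest_point S (\<psi> x - \<phi> x) = \<psi> x"
    by (simp add: natural_map_def)
  show "\<psi> x \<in> S \<and> (\<forall>y\<in>S. \<phi> x \<bullet> (y - \<psi> x) \<ge> 0)"
    using closest_point_in_set[OF S(2,1), of "\<psi> x - \<phi> x"]
      closest_point_dot[OF S(3,2), of _ "\<psi> x - \<phi> x"] by (auto simp: eq)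
next
  assume x: "\<psi> x \<in> S \<and> (\<forall>y\<in>S. \<phi> x \<bullet> (y - \<psi> x) \<ge> 0)"
  have "\<psi> x = closest_point S (\<psi> x - \<phi> x)"
  proof (rule closest_point_unique[OF S(3,2)])
    show "\<forall>y\<in>S. dist (\<psi> x - \<phi> x) (\<psi> x) \<le> dist (\<psi> x - \<phi> x) y"
    proof
      fix y assume "y \<in> S"
      then have "\<phi> x \<bullet> (y - \<psi> x) \<ge> 0"
        using x by auto
      then have "(norm (\<phi> x))\<^sup>2 \<le> (norm (\<phi> x + (y - \<psi> x)))\<^sup>2"
        by (simp add: power2_norm_eq_inner inner_add inner_commute)
      then show "dist (\<psi> x - \<phi> x) (\<psi> x) \<le> dist (\<psi> x - \<phi> x) y"
        by (simp add: dist_norm norm_minus_commute algebra_simps)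
    qed
  qed (use x in auto)
  then show "natural_map \<phi> \<psi> S x = 0"
    by (simp add: natural_map_def)
qed

lemma GCP_SOL_eq_SOL:
  assumes "convex_cone S"
  shows "GCP_SOL D \<phi> \<psi> S = SOL D \<phi> \<psi> S"
proof (intro Set.set_eqI iffI)
  fix x assume "x \<in> GCP_SOL D \<phi> \<psi> S"
  then show "x \<in> SOL D \<phi> \<psi> S"
    by (auto simp: GCP_SOL_def SOL_def dual_cone_def inner_diff_right)
next
  fix x assume x: "x \<in> SOL D \<phi> \<psi> S"
  then have \<psi>: "\<psi> x \<in> S" and le: "\<And>y. y \<in> S \<Longrightarrow> \<phi> x \<bullet> \<psi> x \<le> \<phi> x \<bullet> y"
    by (auto simp: SOL_def inner_diff_right)
  \<comment> \<open>Testing with \<open>0\<close> and with twice \<open>\<psi> x\<close> bounds the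
    product by 0 from above and below.\<close>
  have "\<phi> x \<bullet> \<psi> x = 0"
    using le[OF convex_cone_scaleR[OF assms _ \<psi>], of 0] le[OF convex_cone_scaleR[OF assms _ \<psi>], of 2]
    by simp
  then show "x \<in> GCP_SOL D \<phi> \<psi> S"
    using x le by (auto simp: GCP_SOL_def SOL_def dual_cone_def)
qed

lemma SOL_unique:
  assumes "strictly_monotone_wrt D \<phi> \<psi> S" "x \<in> SOL D \<phi> \<psi> S" "y \<in> SOL D \<phi> \<psi> S"
  shows "x = y"
proof (rule ccontr)
  assume "x \<noteq> y"
  then have "(\<phi> x - \<phi> y) \<bullet> (\<psi> x - \<psi> y) > 0"
    using assms by (auto simp: strictly_monotone_wrt_def SOL_def)
  moreover have "\<phi> x \<bullet> (\<psi> y - \<psi> x) \<ge> 0" "\<phi> y \<bullet> (\<psi> x - \<psi> y) \<ge> 0"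
    using assms by (auto simp: SOL_def)
  ultimately show False
    by (simp add: inner_diff_left inner_diff_right)
qed

section \<open>Weakly homogeneous maps at infinity, and existence of solutions\<close>

lemma weakly_homogeneous_on_imp_continuous_on:
  assumes "weakly_homogeneous_on D \<delta> \<phi> h"
  shows "continuous_on D h" "continuous_on D \<phi>"
proof -
  obtain e where e: "continuous_on D e" "\<And>x. x \<in> D \<Longrightarrow> \<phi> x = h x + e x"
    using assms by (auto simp: weakly_homogeneous_on_def)
  show h: "continuous_on D h"
    using assms by (simp add: weakly_homogeneous_on_def positively_homogeneous_on_def)
  show "continuous_on D \<phi>"
    by (rule continuous_on_eq[OF continuous_on_add[OF h e(1)]]) (simp add: e(2))
qed

text \<open>Homogeneity turns the normalised \<open>h (x n)\<close> into \<open>h\<close> at a unit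
  vector, where continuity applies; the normalised remainder vanishes uniformly in the parameters.
  These are arbitrary in the unit interval, to match the zeros of the homotopy.\<close>

lemma tendsto_weakly_homogeneous:
  fixes x :: "nat \<Rightarrow> 'a::euclidean_space"
  assumes \<phi>: "weakly_homogeneous_on D \<delta> \<phi> h" and D: "closed D" "convex_cone D"
    and x: "\<forall>\<^sub>F n in sequentially. x n \<in> D" "filterlim x at_infinity sequentially"
    and u: "(\<lambda>n. x n /\<^sub>R norm (x n)) \<longlonglongrightarrow> u"
    and t: "\<And>n. t n \<in> {0..1::real}"
  shows "u \<in> D"
    and "(\<lambda>n. (h (x n) + t n *\<^sub>R (\<phi> (x n) - h (x n))) /\<^sub>R (norm (x n) powr \<delta>)) \<longlonglongrightarrow> h u"
proof -
  obtain e where e: "\<And>x. x \<in> D \<Longrightarrow> \<phi> x = h x + e x"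
      "((\<lambda>x. e x /\<^sub>R (norm x powr \<delta>)) \<longlongrightarrow> 0) (inf at_infinity (principal D))"
    using \<phi> by (auto simp: weakly_homogeneous_on_def)
  have hom: "h (c *\<^sub>R x) = (c powr \<delta>) *\<^sub>R h x" if "x \<in> D" "c > 0" for x c
    using \<phi> that by (auto simp: weakly_homogeneous_on_def positively_homogeneous_on_def)
  have x_nz: "\<forall>\<^sub>F n in sequentially. x n \<noteq> 0"
    using x(2) by (rule filterlim_at_infinity_imp_eventually_ne)
  have in_D: "\<forall>\<^sub>F n in sequentially. x n /\<^sub>R norm (x n) \<in> D"
    using x(1) by eventually_elim (auto intro: convex_cone_scaleR[OF D(2)])
  show "u \<in> D"
    using in_D u by (intro Lim_in_closed_set[OF D(1) _ trivial_limit_sequentially])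
  have "(\<lambda>n. h (x n /\<^sub>R norm (x n))) \<longlonglongrightarrow> h u"
    by (rule continuous_on_tendsto_compose[OF weakly_homogeneous_on_imp_continuous_on(1)[OF \<phi>] u
          \<open>u \<in> D\<close> in_D])
  moreover have "(\<lambda>n. t n *\<^sub>R (e (x n) /\<^sub>R (norm (x n) powr \<delta>))) \<longlonglongrightarrow> 0"
  proof (rule Lim_null_comparison)
    have "filterlim x (inf at_infinity (principal D)) sequentially"
      using x by (simp add: filterlim_inf filterlim_principal)
    then have "(\<lambda>n. e (x n) /\<^sub>R (norm (x n) powr \<delta>)) \<longlonglongrightarrow> 0"
      by (rule filterlim_compose[OF e(2)])
    then show "(\<lambda>n. norm (e (x n) /\<^sub>R (norm (x n) powr \<delta>))) \<longlonglongrightarrow> 0"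
      by (rule tendsto_norm_zero)
    have "norm (t n *\<^sub>R y) \<le> norm y" for n and y :: 'a
      using t[of n] by (simp add: mult_left_le_one_le)
    then show "\<forall>\<^sub>F n in sequentially. norm (t n *\<^sub>R (e (x n) /\<^sub>R (norm (x n) powr \<delta>)))
        \<le> norm (e (x n) /\<^sub>R (norm (x n) powr \<delta>))"
      by (intro always_eventually allI)
  qed
  ultimately have "(\<lambda>n. h (x n /\<^sub>R norm (x n)) + t n *\<^sub>R (e (x n) /\<^sub>R (norm (x n) powr \<delta>))) \<longlonglongrightarrow> h u + 0"
    by (rule tendsto_add)
  moreover have "\<forall>\<^sub>F n in sequentially. h (x n /\<^sub>R norm (x n)) + t n *\<^sub>R (e (x n) /\<^sub>R (norm (x n) powr \<delta>))
      = (h (x n) + t n *\<^sub>R (\<phi> (x n) - h (x n))) /\<^sub>R (norm (x n) powr \<delta>)"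
    using x(1) x_nz
  proof eventually_elim
    case (elim n)
    then have "h (x n /\<^sub>R norm (x n)) = h (x n) /\<^sub>R (norm (x n) powr \<delta>)"
      using hom[of "x n" "inverse (norm (x n))"] by (simp add: inverse_powr)
    then show ?case
      using elim e(1) by (simp add: scaleR_add_right mult.commute)
  qed
  ultimately show "(\<lambda>n. (h (x n) + t n *\<^sub>R (\<phi> (x n) - h (x n))) /\<^sub>R (norm (x n) powr \<delta>)) \<longlonglongrightarrow> h u"
    using Lim_transform_eventually by fastforce
qed

text \<open>Far out on the ray of \<open>z\<close> the remainder \<open>g x - ginf x\<close> lies in
  \<open>C\<close>, so \<open>g\<close> maps the scaled point into \<open>C\<close>. This confines
  the zeros of the homotopy at time 0 to \<open>C\<close>, where \<open>Finf\<close> agrees with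
  \<open>finf\<close>.\<close>

lemma leading_term_vimage_cone:
  fixes C :: "'a::euclidean_space set"
  assumes C: "closed C" "convex_cone C"
    and ginf: "positively_homogeneous_on UNIV \<delta> ginf"
    and g_vimage: "g -` C \<subseteq> C"
    and rest: "\<forall>\<^sub>F x in at_infinity. g x - ginf x \<in> C"
    and z: "ginf z \<in> C"
  shows "z \<in> C"
proof (cases "z = 0")
  case True
  then show ?thesis
    using convex_cone_contains_0[OF C(2)] by simp
next
  case False
  obtain B where B: "\<And>x. norm x \<ge> B \<Longrightarrow> g x - ginf x \<in> C"
    using rest by (auto simp: eventually_at_infinity)
  define s where "s = (\<bar>B\<bar> + 1) / norm z"
  have s: "s > 0" "norm (s *\<^sub>R z) \<ge> B"
    using False by (auto simp: s_def)
  have "ginf (s *\<^sub>R z) \<in> C"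
    using ginf s z convex_cone_scaleR[OF C(2)] by (simp add: positively_homogeneous_on_def)
  then have "ginf (s *\<^sub>R z) + (g (s *\<^sub>R z) - ginf (s *\<^sub>R z)) \<in> C"
    using convex_cone_add[OF C(2)] B s by blast
  then have "s *\<^sub>R z \<in> C"
    using g_vimage by auto
  from convex_cone_scaleR[OF C(2) _ this, of "inverse s"] show ?thesis
    using s by simp
qed

lemma SOL_nonempty:
  fixes C K :: "'a::euclidean_space set"
  assumes C: "closed C" "convex_cone C"
    and K: "K \<noteq> {}" "closed K" "convex K" "K \<subseteq> C"
    and f: "weakly_homogeneous_on C \<delta>\<^sub>1 f finf"
    and g: "weakly_homogeneous_on UNIV \<delta>\<^sub>2 g ginf"
    and F: "continuous_on UNIV F" "\<forall>x\<in>C. F x = f x"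
    and Finf: "continuous_on UNIV Finf" "\<forall>x\<in>C. Finf x = finf x"
    and g_vimage: "g -` C \<subseteq> C"
    and rest: "\<forall>\<^sub>F x in at_infinity. g x - ginf x \<in> C"
    and a: "SOL C finf ginf (recession_cone K) = {0}"
    and b: "brouwer_index (natural_map Finf ginf (recession_cone K)) 0 \<noteq> 0"
  shows "SOL C f g K \<noteq> {}"
proof
  assume empty: "SOL C f g K = {}"
  note K' = K(1-3)
  let ?S = "scaled_sum K"
  note S = scaled_sum_nonempty[OF K'] closed_scaled_sum[OF K'] convex_scaled_sum[OF K']
  define Ft where "Ft t x = Finf x + t *\<^sub>R (F x - Finf x)" for t :: real and x
  define gt where "gt t x = ginf x + t *\<^sub>R (g x - ginf x)" for t :: real and x
  define H where "H = (\<lambda>(t, x). natural_map (Ft t) (gt t) (?S t) x)"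
  have H_eq_0: "H (t, x) = 0 \<longleftrightarrow> gt t x \<in> ?S t \<and> (\<forall>y\<in>?S t. Ft t x \<bullet> (y - gt t x) \<ge> 0)"
    if "t \<ge> 0" for t x
    using natural_map_eq_0_iff[OF S(1) S(2)[OF that] S(3)] by (simp add: H_def)
  \<comment> \<open>Boundedness of the zeros is kept as a premise; contraposition with
    \<open>b\<close> yields zeros of arbitrarily large norm.\<close>
  have "brouwer_index (\<lambda>x. H (0, x)) 0 = 0" if R: "\<And>t x. \<lbrakk>t \<in> {0..1}; norm x > R\<rbrakk> \<Longrightarrow> H (t, x) \<noteq> 0" for R
  proof (rule brouwer_index_eq_0[of H R])
    note cont_g = weakly_homogeneous_on_imp_continuous_on[OF g]
    have cont: "continuous_on ({0..1} \<times> UNIV) (\<lambda>z. gt (fst z) (snd z))"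
      "continuous_on ({0..1} \<times> UNIV) (\<lambda>z. Ft (fst z) (snd z))"
      unfolding gt_def Ft_def
      by (intro continuous_intros continuous_on_compose2[OF F(1)] continuous_on_compose2[OF Finf(1)]
          continuous_on_compose2[OF cont_g(1)] continuous_on_compose2[OF cont_g(2)]; simp)+
    have "continuous_on ({0..1} \<times> UNIV)
      (\<lambda>z. (\<lambda>(t, z). closest_point (?S t) z) (fst z, gt (fst z) (snd z) - Ft (fst z) (snd z)))"
      by (rule continuous_on_compose2[OF continuous_on_closest_point_scaled_sum[OF K']])
        (auto intro!: continuous_intros cont)
    then show "continuous_on ({0..1} \<times> UNIV) H"
      unfolding H_def natural_map_def case_prod_beta
      by (intro continuous_on_diff cont) simp
    show "H (0, x) = 0 \<longleftrightarrow> x = 0" for x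
    proof -
      have "x \<in> C" if "ginf x \<in> recession_cone K"
        using leading_term_vimage_cone[OF C _ g_vimage rest] recession_cone_subset[OF K' C K(4)]
          g that by (auto simp: weakly_homogeneous_on_def)
      then have "H (0, x) = 0 \<longleftrightarrow> x \<in> SOL C finf ginf (recession_cone K)"
        using Finf(2) by (auto simp: H_eq_0 scaled_sum_0[OF K'] Ft_def gt_def SOL_def)
      then show ?thesis
        by (simp add: a)
    qed
    show "H (t, x) \<noteq> 0" if "t \<in> {0..1}" "norm x > R" for t x
      by (rule R[OF that])
    show "H (1, x) \<noteq> 0" for x
    proof
      assume "H (1, x) = 0"
      then have x: "g x \<in> K" "\<forall>y\<in>K. F x \<bullet> (y - g x) \<ge> 0"
        by (auto simp: H_eq_0 scaled_sum_1[OF K'] Ft_def gt_def)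
      moreover from this have "x \<in> C"
        using g_vimage K by auto
      ultimately have "x \<in> SOL C f g K"
        using F(2) by (simp add: SOL_def)
      with empty show False by simp
    qed
  qed
  moreover have "(\<lambda>x. H (0, x)) = natural_map Finf ginf (recession_cone K)"
    by (auto simp: H_def Ft_def gt_def scaled_sum_0[OF K'] natural_map_def)
  ultimately have "\<exists>t x. t \<in> {0..1} \<and> norm x > R \<and> H (t, x) = 0" for R
    using b by metis
  then have "\<forall>n::nat. \<exists>t x. t \<in> {0..1} \<and> norm x > real n \<and> H (t, x) = 0"
    by blast
  then obtain t x where t: "\<And>n. t n \<in> {0..1}" and x: "\<And>n. norm (x n) > real n"
    and zero: "\<And>n. H (t n, x n) = 0"
    by metis
  define w where "w n = x n /\<^sub>R norm (x n)" for n
  have w_sphere: "w n \<in> sphere 0 1" for n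
  proof -
    have "norm (x n) > 0"
      using x[of n] by linarith
    then show ?thesis
      by (simp add: w_def)
  qed
  have "\<exists>l\<in>sphere 0 1. \<exists>r :: nat \<Rightarrow> nat. strict_mono r \<and> (w \<circ> r) \<longlonglongrightarrow> l"
    by (rule compact_sphere[unfolded compact_def, THEN spec[of _ w], THEN mp]) (rule allI, rule w_sphere)
  then obtain u r where u: "u \<in> sphere 0 1" and r: "strict_mono r"
    and lim_r: "(w \<circ> r) \<longlonglongrightarrow> u"
    by (elim bexE exE conjE) (rule that)
  define y where "y n = x (r n)" for n
  define \<tau> where "\<tau> n = t (r n)" for n
  have \<tau>: "\<tau> n \<in> {0..1}" for n
    using t by (simp add: \<tau>_def)
  have y_large: "norm (y n) > real n" for n
    using x[of "r n"] seq_suble[OF r, of n] by (simp add: y_def)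
  have lim_u: "(\<lambda>n. y n /\<^sub>R norm (y n)) \<longlonglongrightarrow> u"
    using lim_r by (simp add: y_def w_def o_def)
  have norm_y: "filterlim (\<lambda>n. norm (y n)) at_top sequentially"
    by (rule filterlim_at_top_mono[OF filterlim_real_sequentially])
      (use y_large in \<open>auto intro: always_eventually less_imp_le\<close>)
  then have y_inf: "filterlim y at_infinity sequentially"
    by (rule filterlim_norm_at_top_imp_at_infinity)
  have sol: "gt (\<tau> n) (y n) \<in> ?S (\<tau> n)"
    "\<And>v. v \<in> ?S (\<tau> n) \<Longrightarrow> Ft (\<tau> n) (y n) \<bullet> (v - gt (\<tau> n) (y n)) \<ge> 0" for n
    using zero[of "r n"] \<tau>[of n] H_eq_0[of "\<tau> n" "y n"] by (auto simp: \<tau>_def y_def)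
  \<comment> \<open>Adding \<open>(1 - \<tau> n) *\<^sub>R (g (y n) - ginf (y n))\<close> completes
    \<open>gt\<close> to \<open>g\<close> within \<open>C\<close>.\<close>
  have y_C: "\<forall>\<^sub>F n in sequentially. y n \<in> C"
    using eventually_compose_filterlim[OF rest y_inf]
  proof eventually_elim
    case (elim n)
    have "gt (\<tau> n) (y n) \<in> C"
      using sol(1) scaled_sum_subset_cone[OF K' C K(4), of "\<tau> n"] \<tau>[of n] by auto
    moreover have "(1 - \<tau> n) *\<^sub>R (g (y n) - ginf (y n)) \<in> C"
      using elim \<tau>[of n] by (intro convex_cone_scaleR[OF C(2)]) auto
    ultimately have "gt (\<tau> n) (y n) + (1 - \<tau> n) *\<^sub>R (g (y n) - ginf (y n)) \<in> C"
      by (rule convex_cone_add[OF C(2)])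
    then have "g (y n) \<in> C"
      by (simp add: gt_def algebra_simps)
    then show "y n \<in> C"
      using g_vimage by auto
  qed
  have u_C: "u \<in> C"
    by (rule tendsto_weakly_homogeneous(1)[OF f C y_C y_inf lim_u \<tau>])
  \<comment> \<open>\<open>Ft\<close> is expressed by \<open>f\<close> and \<open>finf\<close> only
    on \<open>C\<close>, hence along the tail given by \<open>y_C\<close>.\<close>
  have lim_f: "(\<lambda>n. Ft (\<tau> n) (y n) /\<^sub>R (norm (y n) powr \<delta>\<^sub>1)) \<longlonglongrightarrow> finf u"
  proof (rule Lim_transform_eventually[OF tendsto_weakly_homogeneous(2)[OF f C y_C y_inf lim_u \<tau>]])
    show "\<forall>\<^sub>F n in sequentially. (finf (y n) + \<tau> n *\<^sub>R (f (y n) - finf (y n))) /\<^sub>R (norm (y n) powr \<delta>\<^sub>1)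
        = Ft (\<tau> n) (y n) /\<^sub>R (norm (y n) powr \<delta>\<^sub>1)"
      using y_C by eventually_elim (use F(2) Finf(2) in \<open>simp add: Ft_def\<close>)
  qed
  have lim_g: "(\<lambda>n. gt (\<tau> n) (y n) /\<^sub>R (norm (y n) powr \<delta>\<^sub>2)) \<longlonglongrightarrow> ginf u"
    unfolding gt_def
    by (rule tendsto_weakly_homogeneous(2)[OF g _ _ _ y_inf lim_u \<tau>]) (auto simp: convex_cone_iff)
  \<comment> \<open>Multiplication by \<open>c\<close> carries \<open>scaled_sum K t\<close> into
    \<open>scaled_sum K (c * t)\<close>, so \<open>\<nu> n\<close> is the parameter of the set
    containing the normalised \<open>gt\<close>. It tends to 0 because
    \<open>\<delta>\<^sub>2 > 0\<close> and \<open>\<tau> n\<close> is bounded.\<close>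
  define \<nu> where "\<nu> n = inverse (norm (y n) powr \<delta>\<^sub>2) * \<tau> n" for n
  have lim_\<nu>: "\<nu> \<longlonglongrightarrow> 0"
  proof (rule Lim_null_comparison)
    have "\<delta>\<^sub>2 > 0"
      using g by (simp add: weakly_homogeneous_on_def)
    then show "(\<lambda>n. inverse (norm (y n) powr \<delta>\<^sub>2)) \<longlonglongrightarrow> 0"
      using tendsto_neg_powr[OF _ norm_y, of "- \<delta>\<^sub>2"] by (simp add: powr_minus)
    show "\<forall>\<^sub>F n in sequentially. norm (\<nu> n) \<le> inverse (norm (y n) powr \<delta>\<^sub>2)"
      using \<tau> by (auto simp: \<nu>_def abs_mult mult_left_le intro!: always_eventually)
  qed
  have lim: "(\<lambda>n. (\<nu> n, gt (\<tau> n) (y n) /\<^sub>R (norm (y n) powr \<delta>\<^sub>2))) \<longlonglongrightarrow> (0, ginf u)"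
    by (intro tendsto_Pair lim_\<nu> lim_g)
  have in_graph: "(\<nu> n, gt (\<tau> n) (y n) /\<^sub>R (norm (y n) powr \<delta>\<^sub>2)) \<in> {(t, y). 0 \<le> t \<and> y \<in> ?S t}" for n
    using scaleR_mem_scaled_sum[OF K' sol(1)] \<tau> by (auto simp: \<nu>_def)
  have "(0, ginf u) \<in> {(t, y). 0 \<le> t \<and> y \<in> ?S t}"
    by (rule closed_sequentially[OF closed_scaled_sum_graph[OF K'] in_graph lim])
  then have g_u: "ginf u \<in> recession_cone K"
    by (simp add: scaled_sum_0[OF K'])
  have "finf u \<bullet> (v - ginf u) \<ge> 0" if v: "v \<in> recession_cone K" for v
  proof -
    obtain k where k: "k \<in> K"
      using K by auto
    \<comment> \<open>The test point is \<open>\<tau> n *\<^sub>R k + c *\<^sub>R v\<close> with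
      \<open>c = norm (y n) powr \<delta>\<^sub>2\<close>: after division by \<open>c\<close> it
      becomes \<open>\<nu> n *\<^sub>R k + v\<close>, which tends to \<open>v\<close>. The positive
      factor at \<open>Ft\<close> preserves the sign.\<close>
    have "(\<lambda>n. (Ft (\<tau> n) (y n) /\<^sub>R (norm (y n) powr \<delta>\<^sub>1)) \<bullet>
          (\<nu> n *\<^sub>R k + v - gt (\<tau> n) (y n) /\<^sub>R (norm (y n) powr \<delta>\<^sub>2))) \<longlonglongrightarrow> finf u \<bullet> (0 *\<^sub>R k + v - ginf u)"
      by (intro tendsto_intros lim_f lim_g lim_\<nu>)
    moreover have "(Ft (\<tau> n) (y n) /\<^sub>R (norm (y n) powr \<delta>\<^sub>1)) \<bullet>
          (\<nu> n *\<^sub>R k + v - gt (\<tau> n) (y n) /\<^sub>R (norm (y n) powr \<delta>\<^sub>2)) \<ge> 0" for n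
    proof -
      define c where "c = norm (y n) powr \<delta>\<^sub>2"
      have c: "c > 0"
        using y_large[of n] by (auto simp: c_def)
      have "c *\<^sub>R v \<in> recession_cone K"
        using convex_cone_scaleR[OF convex_cone_recession_cone[OF K'] _ v] c by simp
      then have "\<tau> n *\<^sub>R k + c *\<^sub>R v \<in> ?S (\<tau> n)"
        using k by (auto simp: scaled_sum_def)
      from sol(2)[OF this] have "0 \<le> Ft (\<tau> n) (y n) \<bullet> (\<tau> n *\<^sub>R k + c *\<^sub>R v - gt (\<tau> n) (y n))" .
      moreover have "\<tau> n *\<^sub>R k + c *\<^sub>R v - gt (\<tau> n) (y n)
          = c *\<^sub>R (\<nu> n *\<^sub>R k + v - gt (\<tau> n) (y n) /\<^sub>R c)"
        using c by (simp add: \<nu>_def scaleR_add_right scaleR_diff_right flip: c_def)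
      ultimately show ?thesis
        using c by (simp add: zero_le_mult_iff flip: c_def)
    qed
    ultimately have "0 \<le> finf u \<bullet> (0 *\<^sub>R k + v - ginf u)"
      by (intro LIMSEQ_le_const) auto
    then show ?thesis
      by simp
  qed
  then have "u \<in> SOL C finf ginf (recession_cone K)"
    using u_C g_u by (simp add: SOL_def)
  then show False
    using a u by simp
qed

theorem mainTheorem7:
  fixes C K :: "'a::euclidean_space set"
    and f finf fbar g ginf gbar F Finf :: "'a \<Rightarrow> 'a"
    and p q :: 'a and \<delta>\<^sub>1 \<delta>\<^sub>2 :: real
  assumes C: "closed C" "convex_cone C"
    and K: "K \<noteq> {}" "closed K" "convex K" "K \<subseteq> C"
    and f: "weakly_homogeneous_on C \<delta>\<^sub>1 f finf" "\<forall>x\<in>C. f x = finf x + fbar x + p"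
    and g: "weakly_homogeneous_on UNIV \<delta>\<^sub>2 g ginf" "\<forall>x. g x = ginf x + gbar x + q"
    and F: "continuous_on UNIV F" "\<forall>x\<in>C. F x = f x"
    and Finf: "continuous_on UNIV Finf" "\<forall>x\<in>C. Finf x = finf x"
    and g_vimage: "g -` C \<subseteq> C"
    and gbar: "\<forall>\<^sub>F x in at_infinity. gbar x + q \<in> C"
    and a: "SOL C finf ginf (recession_cone K) = {0}"
    and b: "brouwer_index (natural_map Finf ginf (recession_cone K)) 0 \<noteq> 0"
  shows "(strictly_monotone_wrt C f g K \<longrightarrow> (\<exists>!x. x \<in> SOL C f g K)) \<and>
         (strictly_monotone_wrt C f g (recession_cone K) \<longrightarrow>
            (\<exists>!x. x \<in> GCP_SOL C f g (recession_cone K)))"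
proof -
  let ?R = "recession_cone K"
  note R = convex_cone_recession_cone[OF K(1-3)] closed_recession_cone[OF K(1-3)]
  have "gbar x + q = g x - ginf x" for x
    using g(2) by (simp add: algebra_simps)
  then have rest: "\<forall>\<^sub>F x in at_infinity. g x - ginf x \<in> C"
    using gbar by simp
  note nonempty = SOL_nonempty[OF C _ _ _ _ f(1) g(1) F Finf g_vimage rest]
  have "SOL C f g K \<noteq> {}"
    by (rule nonempty[OF K a b])
  \<comment> \<open>\<open>a\<close> and \<open>b\<close> see the convex set only through its
    recession cone, so they carry over to \<open>?R\<close> unchanged.\<close>
  moreover have "SOL C f g ?R \<noteq> {}"
    using R recession_cone_subset[OF K(1-3) C K(4)] recession_cone_cone[OF R(2,1)] a b
    by (intro nonempty) (auto simp: convex_cone_def)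
  ultimately show ?thesis
    unfolding GCP_SOL_eq_SOL[OF R(1)] using SOL_unique by blast
qed

end
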